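(* Let $A(n)$, $n \geq 0$, be a C-finite sequence of rational numbers. Then $A(n)$ is a constant term if and only if it has a single characteristic root $\lambda$ and $\lambda \in \mathbb{Q}$.
   Context: Constant term: for a Laurent polynomial $F \in \mathbb{Q}[\boldsymbol{x}^{\pm 1}] = \mathbb{Q}[x_1^{\pm 1}, \ldots, x_d^{\pm 1}]$, $\operatorname{ct}[F]$ denotes its constant coefficient (the coefficient of $x_1^0 \cdots x_d^0$). A sequence $(A(n))_{n \geq 0}$ is a constant term if there exist $d$ and Laurent polynomials $P, Q \in \mathbb{Q}[x_1^{\pm 1}, \ldots, x_d^{\pm 1}]$ such that $A(n) = \operatorname{ct}[P(\boldsymbol{x})^n Q(\boldsymbol{x})]$ for all $n \geq 0$ (with $P^0 = 1$). C-finite: a sequence $(A(n))_{n\ge 0}$ of rational numbers is C-finite if there is a nonzero polynomial $P(x) \in \mathbb{Q}[x]$ such that $P(N) A(n) = 0$ for all $n \geq 0$, where $N$ is the shift operator, $N^\ell A(n) = A(n+\ell)$. The characteristic roots of $A(n)$ are the complex roots of such a $P$ of minimal degree, with multiplicities; in particular $0$ may be a characteristic root. A characteristic root may be repeated; "single characteristic root" means that there is exactly one distinct root.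
   Formalization: The sequence A(n) is assumed not to be identically zero, since the zero sequence is a C-finite constant term (take Q = 0) but has no characteristic root, so the stated equivalence fails for it. *)

theory Defs
  imports
    Complex_Main
    "HOL-Library.Poly_Mapping"
    "HOL-Computational_Algebra.Polynomial"
begin

text \<open>
  A Laurent monomial in the variables \<open>x\<^sub>0, x\<^sub>1, \<dots>\<close> is its finitely supported exponent vector
  \<open>nat \<Rightarrow>\<^sub>0 int\<close>, and a Laurent polynomial is a finitely supported map from exponent vectors to
  rational coefficients, with the convolution product of \<open>Poly_Mapping\<close>. The ring in \<open>d\<close>
  variables consists of those in which only \<open>x\<^sub>i\<close> with \<open>i < d\<close> occur.
\<close>

type_synonym laurent = "(nat \<Rightarrow>\<^sub>0 int) \<Rightarrow>\<^sub>0 rat"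

definition laurent_ring :: "nat \<Rightarrow> laurent set" where
  "laurent_ring d = {F. \<forall>m \<in> Poly_Mapping.keys F. Poly_Mapping.keys m \<subseteq> {..<d}}"

definition ct :: "laurent \<Rightarrow> rat" where
  "ct F = Poly_Mapping.lookup F 0"

definition constant_term :: "(nat \<Rightarrow> rat) \<Rightarrow> bool" where
  "constant_term A \<longleftrightarrow>
     (\<exists>d. \<exists>P \<in> laurent_ring d. \<exists>Q \<in> laurent_ring d. \<forall>n. A n = ct (P ^ n * Q))"

text \<open>\<open>shift_apply P A\<close> is the sequence \<open>P(N) A\<close>, where \<open>N\<close> is the shift operator.\<close>

definition shift_apply :: "rat poly \<Rightarrow> (nat \<Rightarrow> rat) \<Rightarrow> nat \<Rightarrow> rat" where
  "shift_apply P A n = (\<Sum>l\<le>degree P. coeff P l * A (n + l))"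

definition annihilates :: "rat poly \<Rightarrow> (nat \<Rightarrow> rat) \<Rightarrow> bool" where
  "annihilates P A \<longleftrightarrow> (\<forall>n. shift_apply P A n = 0)"

definition C_finite :: "(nat \<Rightarrow> rat) \<Rightarrow> bool" where
  "C_finite A \<longleftrightarrow> (\<exists>P. P \<noteq> 0 \<and> annihilates P A)"

definition minimal_annihilator :: "rat poly \<Rightarrow> (nat \<Rightarrow> rat) \<Rightarrow> bool" where
  "minimal_annihilator P A \<longleftrightarrow>
     P \<noteq> 0 \<and> annihilates P A \<and> (\<forall>R. R \<noteq> 0 \<and> annihilates R A \<longrightarrow> degree P \<le> degree R)"

text \<open>
  Minimal annihilators of a C-finite sequence agree up to a nonzero scalar, so the quantifier over
  \<open>P\<close> below does not enlarge the set of roots. Only the distinct roots are recorded. The zero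
  sequence is annihilated by the constant polynomial \<open>1\<close> and hence has no characteristic root.
\<close>

definition char_roots :: "(nat \<Rightarrow> rat) \<Rightarrow> complex set" where
  "char_roots A = {z. \<exists>P. minimal_annihilator P A \<and> poly (map_poly of_rat P) z = 0}"

end

theory Submission
  imports Defs
    "HOL-Computational_Algebra.Fundamental_Theorem_Algebra"
    "HOL-Computational_Algebra.Primes"
begin

text \<open>
  Suppose \<open>A n = ct (P ^ n * Q)\<close> satisfies a linear recurrence, and put \<open>c = ct P\<close>. The only
  characteristic root can be \<open>c\<close>, and this is seen modulo all large primes \<open>p\<close>. Modulo \<open>p\<close> the
  power \<open>P ^ p\<close> is a polynomial in the \<open>p\<close>-th powers of the monomials, so that only its constant
  coefficient can meet a fixed Laurent polynomial with exponents below \<open>p\<close>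
  (\<open>ct_power_prime_mult\<close>). Applied to \<open>P ^ k * Q\<close> this gives \<open>A (p + k) \<equiv> c * A k\<close> for the
  finitely many \<open>k\<close> below the order of the recurrence, and the recurrence extends it to all \<open>k\<close>
  (\<open>divisible_if_annihilated\<close>). Since also \<open>(N - c) ^ p \<equiv> N ^ p - c\<close>, where \<open>N\<close> is the shift, the
  operator \<open>N - c\<close> is nilpotent on \<open>A\<close> modulo \<open>p\<close>.

  The exponent of nilpotency can be made independent of \<open>p\<close>. Write the recurrence as
  \<open>(x - c) ^ i * q\<close> with \<open>q\<close> not vanishing at \<open>c\<close>. On \<open>B = (N - c) ^ i A\<close>, which \<open>q(N)\<close>
  annihilates, \<open>N - c\<close> has a polynomial inverse \<open>w(N)\<close>; so \<open>B = w(N) ^ p (N - c) ^ p B\<close> is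
  divisible by every large \<open>p\<close>, and therefore zero
  (\<open>constant_term_annihilated_by_linear_power\<close>). The minimal annihilator then divides
  \<open>(x - c) ^ i\<close>.

  Conversely, if the only characteristic root is rational, say \<open>l\<close>, then some \<open>(N - l) ^ m\<close>
  annihilates \<open>A\<close>. Expanding \<open>N ^ n = ((N - l) + l) ^ n\<close> binomially and evaluating at \<open>0\<close> gives
  \<open>A n = (\<Sum>k<m. (n choose k) * l ^ (n - k) * T k)\<close> with \<open>T k = ((N - l) ^ k A) 0\<close>, which is the
  constant term of \<open>(x + l) ^ n * (\<Sum>k<m. T k * x ^ (- k))\<close>. This covers \<open>l = 0\<close> as well.
\<close>

section \<open>Polynomials in the shift operator\<close>

lemma shift_apply_eq_sum:
  assumes "degree P \<le> M"
  shows "shift_apply P A n = (\<Sum>l\<le>M. coeff P l * A (n + l))"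
  unfolding shift_apply_def
  by (rule sum.mono_neutral_left) (use assms in \<open>auto simp: coeff_eq_0\<close>)

lemma shift_apply_0 [simp]: "shift_apply 0 A n = 0"
  by (simp add: shift_apply_def)

text \<open>
  Horner's scheme. It replaces the degree bound in \<open>shift_apply_def\<close> by an induction over \<open>pCons\<close>,
  from which all algebraic properties of \<open>shift_apply\<close> follow.
\<close>

lemma shift_apply_pCons:
  "shift_apply (pCons a P) A n = a * A n + shift_apply P A (Suc n)"
proof -
  have "shift_apply (pCons a P) A n = (\<Sum>l\<le>Suc (degree P). coeff (pCons a P) l * A (n + l))"
    by (rule shift_apply_eq_sum) (rule degree_pCons_le)
  also have "\<dots> = a * A n + shift_apply P A (Suc n)"
    by (simp only: sum.atMost_Suc_shift) (simp add: shift_apply_def)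
  finally show ?thesis .
qed

lemma shift_apply_1 [simp]: "shift_apply 1 A = A"
  by (rule ext) (simp add: one_pCons shift_apply_pCons)

lemma shift_apply_add:
  "shift_apply (P + Q) A n = shift_apply P A n + shift_apply Q A n"
proof (induction P Q arbitrary: n rule: poly_induct2)
  case 0
  then show ?case by simp
next
  case (pCons a P b Q)
  then show ?case by (simp add: shift_apply_pCons algebra_simps)
qed

lemma shift_apply_smult: "shift_apply (smult c P) A n = c * shift_apply P A n"
  by (induction P arbitrary: n) (simp_all add: shift_apply_pCons algebra_simps)

lemma shift_apply_diff:
  "shift_apply (P - Q) A n = shift_apply P A n - shift_apply Q A n"
  using shift_apply_add[of "P - Q" Q A n] by simp

lemma shift_apply_sum: "shift_apply (\<Sum>i\<in>I. f i) A n = (\<Sum>i\<in>I. shift_apply (f i) A n)"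
  by (induction I rule: infinite_finite_induct) (simp_all add: shift_apply_add)

text \<open>The sequences are thus a module over the polynomial ring, and annihilators form an ideal.\<close>

lemma shift_apply_mult: "shift_apply (P * Q) A = shift_apply P (shift_apply Q A)"
proof
  show "shift_apply (P * Q) A n = shift_apply P (shift_apply Q A) n" for n
    by (induction P arbitrary: n)
      (simp_all add: shift_apply_pCons shift_apply_add shift_apply_smult)
qed

lemma shift_apply_X_power: "shift_apply ([:0, 1:] ^ k) A n = A (n + k)"
  by (induction k arbitrary: n) (simp_all add: shift_apply_mult shift_apply_pCons)

lemma shift_apply_zero_sequence [simp]: "shift_apply P (\<lambda>n. 0) = (\<lambda>n. 0)"
  by (simp add: shift_apply_def fun_eq_iff)

lemma annihilates_iff: "annihilates P A \<longleftrightarrow> shift_apply P A = (\<lambda>n. 0)"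
  by (auto simp: annihilates_def)

lemma annihilates_mult: "annihilates Q A \<Longrightarrow> annihilates (P * Q) A"
  by (simp add: annihilates_iff shift_apply_mult)

lemma minimal_annihilator_exists:
  assumes "C_finite A"
  obtains P where "minimal_annihilator P A"
proof -
  have "\<exists>P. P \<noteq> 0 \<and> annihilates P A"
    using assms by (simp add: C_finite_def)
  then obtain P where "is_arg_min degree (\<lambda>P. P \<noteq> 0 \<and> annihilates P A) P"
    using ex_has_least_nat[of "\<lambda>P. P \<noteq> 0 \<and> annihilates P A" _ degree]
    by (auto simp: is_arg_min_linorder)
  then show thesis
    by (intro that) (auto simp: minimal_annihilator_def is_arg_min_linorder)
qed

lemma minimal_annihilator_dvd:
  assumes "minimal_annihilator P A" and "annihilates R A"
  shows "P dvd R"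
proof -
  have "R mod P = R - (R div P) * P"
    by (simp add: minus_div_mult_eq_mod)
  then have "annihilates (R mod P) A"
    using assms annihilates_mult[of P A "R div P"]
    by (simp add: annihilates_def shift_apply_diff minimal_annihilator_def)
  then have "R mod P = 0"
    using assms(1) degree_mod_less[of P R]
    by (force simp: minimal_annihilator_def)
  then show ?thesis by (simp add: dvd_eq_mod_eq_0)
qed

section \<open>Complex roots of rational polynomials\<close>

lemma poly_of_rat_add:
  "poly (map_poly of_rat (P + Q)) (z :: complex) =
     poly (map_poly of_rat P) z + poly (map_poly of_rat Q) z"
  by (induction P Q rule: poly_induct2)
    (simp_all add: map_poly_pCons of_rat_add algebra_simps)

lemma poly_of_rat_smult:
  "poly (map_poly of_rat (smult c P)) (z :: complex) = of_rat c * poly (map_poly of_rat P) z"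
  by (induction P) (simp_all add: map_poly_pCons of_rat_mult algebra_simps)

lemma poly_of_rat_mult:
  "poly (map_poly of_rat (P * Q)) (z :: complex) =
     poly (map_poly of_rat P) z * poly (map_poly of_rat Q) z"
  by (induction P)
    (simp_all add: map_poly_pCons poly_of_rat_add poly_of_rat_smult algebra_simps)

lemma poly_of_rat_linear_power:
  "poly (map_poly of_rat ([:- c, 1:] ^ m)) (z :: complex) = (z - of_rat c) ^ m"
  by (induction m) (simp_all add: poly_of_rat_mult map_poly_pCons of_rat_minus del: mult_pCons_left)

lemma complex_root_exists:
  fixes P :: "rat poly"
  assumes "degree P > 0"
  obtains z :: complex where "poly (map_poly of_rat P) z = 0"
proof -
  have "degree (map_poly (of_rat :: rat \<Rightarrow> complex) P) > 0"
    using assms by (simp add: degree_map_poly)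
  then show thesis
    using alg_closed_imp_poly_has_root that by blast
qed

text \<open>
  Splitting off all factors \<open>x - c\<close> leaves a cofactor without complex roots, hence a constant.
\<close>

lemma eq_linear_power_if_single_root:
  fixes P :: "rat poly"
  assumes "P \<noteq> 0" and "\<And>z :: complex. poly (map_poly of_rat P) z = 0 \<Longrightarrow> z = of_rat c"
  obtains a m where "a \<noteq> 0" "P = smult a ([:- c, 1:] ^ m)"
proof -
  obtain Q where Q: "P = [:- c, 1:] ^ order c P * Q" "\<not> [:- c, 1:] dvd Q"
    using order_decomp[OF \<open>P \<noteq> 0\<close>] by blast
  have "poly (map_poly of_rat Q) z \<noteq> 0" for z :: complex
  proof
    assume z: "poly (map_poly of_rat Q) z = 0"
    then have "z = of_rat c"
      by (intro assms(2)) (subst Q(1), simp add: poly_of_rat_mult)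
    moreover have "poly (map_poly of_rat Q) (of_rat c :: complex) = of_rat (poly Q c)"
      by (induction Q) (simp_all add: map_poly_pCons of_rat_add of_rat_mult)
    ultimately show False
      using z Q(2) by (simp add: poly_eq_0_iff_dvd)
  qed
  then have "degree Q = 0"
    using complex_root_exists by blast
  then obtain a where "Q = [:a:]"
    by (rule degree_eq_zeroE)
  then show thesis
    using that[of a "order c P"] Q(1) \<open>P \<noteq> 0\<close> by (cases "a = 0") auto
qed

section \<open>Frobenius congruences in subrings\<close>

text \<open>
  Congruences modulo \<open>p\<close> are needed for rationals, for polynomials and for Laurent polynomials, in
  each case with all coefficients in the ring of rationals that are integral at \<open>p\<close>. Treating
  these as subrings \<open>S\<close> of commutative rings lets one Frobenius congruence, with an error term in
  \<open>p S\<close>, serve them all and avoids passing to quotient rings.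
\<close>

locale unital_subring =
  fixes S :: "'a :: comm_ring_1 set"
  assumes one_closed: "1 \<in> S"
    and add_closed: "x \<in> S \<Longrightarrow> y \<in> S \<Longrightarrow> x + y \<in> S"
    and mult_closed: "x \<in> S \<Longrightarrow> y \<in> S \<Longrightarrow> x * y \<in> S"
    and uminus_closed: "x \<in> S \<Longrightarrow> - x \<in> S"
begin

lemma zero_closed: "0 \<in> S"
  using add_closed[OF one_closed uminus_closed[OF one_closed]] by simp

lemma sum_closed: "(\<And>i. i \<in> I \<Longrightarrow> f i \<in> S) \<Longrightarrow> sum f I \<in> S"
  by (induction I rule: infinite_finite_induct) (auto intro: zero_closed add_closed)

lemma power_closed: "x \<in> S \<Longrightarrow> x ^ n \<in> S"
  by (induction n) (auto intro: one_closed mult_closed)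

lemma of_nat_closed: "of_nat n \<in> S"
  by (induction n) (auto intro: zero_closed one_closed add_closed)

lemma frobenius_add:
  assumes "prime p" "x \<in> S" "y \<in> S"
  obtains K where "K \<in> S" "(x + y) ^ p = x ^ p + y ^ p + of_nat p * K"
proof
  \<comment> \<open>\<open>p\<close> divides all binomial coefficients except the two outer ones.\<close>
  define K where "K = (\<Sum>k\<in>{1..<p}. of_nat ((p choose k) div p) * x ^ k * y ^ (p - k))"
  show "K \<in> S"
    unfolding K_def
    by (intro sum_closed mult_closed of_nat_closed power_closed assms)
  have p: "p > 0" using assms(1) by (rule prime_gt_0_nat)
  have "(x + y) ^ p = (\<Sum>k\<le>p. of_nat (p choose k) * x ^ k * y ^ (p - k))"
    by (rule binomial_ring)
  also have "{..p} = insert 0 (insert p {1..<p})"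
    using p by auto
  also have "(\<Sum>k\<in>insert 0 (insert p {1..<p}). of_nat (p choose k) * x ^ k * y ^ (p - k)) =
      x ^ p + y ^ p + (\<Sum>k\<in>{1..<p}. of_nat (p choose k) * x ^ k * y ^ (p - k))"
    using p by simp
  also have "(\<Sum>k\<in>{1..<p}. of_nat (p choose k) * x ^ k * y ^ (p - k)) = of_nat p * K"
    unfolding K_def sum_distrib_left
  proof (rule sum.cong)
    fix k assume "k \<in> {1..<p}"
    then have "p dvd (p choose k)"
      by (intro dvd_choose_prime) (use assms(1) in auto)
    then have "of_nat (p choose k) = (of_nat p * of_nat ((p choose k) div p) :: 'a)"
      by (metis dvd_mult_div_cancel of_nat_mult)
    then show "of_nat (p choose k) * x ^ k * y ^ (p - k) =
        of_nat p * (of_nat ((p choose k) div p) * x ^ k * y ^ (p - k))"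
      by (simp add: mult.assoc)
  qed simp
  finally show "(x + y) ^ p = x ^ p + y ^ p + of_nat p * K" .
qed

lemma frobenius_sum:
  assumes "prime p" "finite I" "\<And>i. i \<in> I \<Longrightarrow> f i \<in> S"
  obtains K where "K \<in> S" "sum f I ^ p = (\<Sum>i\<in>I. f i ^ p) + of_nat p * K"
proof -
  from assms(2,3) have "\<exists>K\<in>S. sum f I ^ p = (\<Sum>i\<in>I. f i ^ p) + of_nat p * K"
  proof (induction I rule: finite_induct)
    case empty
    show ?case
      using prime_gt_0_nat[OF assms(1)] zero_closed by (auto simp: power_0_left intro!: bexI[of _ 0])
  next
    case (insert i I)
    then obtain K where K: "K \<in> S" "sum f I ^ p = (\<Sum>i\<in>I. f i ^ p) + of_nat p * K"
      by auto
    have mem: "f i \<in> S" "sum f I \<in> S"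
      using insert.prems by (auto intro!: sum_closed)
    obtain L where L: "L \<in> S" "(f i + sum f I) ^ p = f i ^ p + sum f I ^ p + of_nat p * L"
      by (rule frobenius_add[OF assms(1) mem])
    show ?case
      using insert.hyps K L by (intro bexI[of _ "K + L"]) (auto simp: algebra_simps add_closed)
  qed
  then show thesis using that by blast
qed

lemma poly_subring: "unital_subring {P :: 'a poly. \<forall>i. coeff P i \<in> S}"
proof
  show "1 \<in> {P :: 'a poly. \<forall>i. coeff P i \<in> S}"
    by (simp add: zero_closed one_closed)
  show "P * Q \<in> {P. \<forall>i. coeff P i \<in> S}"
    if "P \<in> {P. \<forall>i. coeff P i \<in> S}" "Q \<in> {P. \<forall>i. coeff P i \<in> S}" for P Q :: "'a poly"
    using that by (auto simp: coeff_mult intro!: sum_closed mult_closed)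
qed (auto intro: add_closed uminus_closed)

end

section \<open>Laurent polynomials\<close>

lemma poly_mapping_eq_sum_single:
  "F = (\<Sum>k\<in>Poly_Mapping.keys F. Poly_Mapping.single k (Poly_Mapping.lookup F k))"
  by (rule poly_mapping_eqI)
    (simp add: lookup_sum lookup_single when_def in_keys_iff)

lemma lookup_single_mult:
  fixes F :: "'a :: ab_group_add \<Rightarrow>\<^sub>0 'b :: comm_ring_1"
  shows "Poly_Mapping.lookup (Poly_Mapping.single k c * F) m = c * Poly_Mapping.lookup F (m - k)"
proof -
  have "Poly_Mapping.single k c * F =
      (\<Sum>l\<in>Poly_Mapping.keys F. Poly_Mapping.single (k + l) (c * Poly_Mapping.lookup F l))"
    by (subst (1) poly_mapping_eq_sum_single[of F]) (simp add: sum_distrib_left mult_single)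
  then have "Poly_Mapping.lookup (Poly_Mapping.single k c * F) m =
      (\<Sum>l\<in>Poly_Mapping.keys F. if l = m - k then c * Poly_Mapping.lookup F l else 0)"
    by (auto simp: lookup_sum lookup_single when_def algebra_simps intro!: sum.cong)
  also have "\<dots> = c * Poly_Mapping.lookup F (m - k)"
    by (simp add: in_keys_iff)
  finally show ?thesis .
qed

lemma (in unital_subring) laurent_subring:
  "unital_subring {F :: 'b :: ab_group_add \<Rightarrow>\<^sub>0 'a. \<forall>m. Poly_Mapping.lookup F m \<in> S}"
proof
  show "1 \<in> {F :: 'b \<Rightarrow>\<^sub>0 'a. \<forall>m. Poly_Mapping.lookup F m \<in> S}"
    by (simp add: lookup_one when_def zero_closed one_closed)
  show "F * G \<in> {F. \<forall>m. Poly_Mapping.lookup F m \<in> S}"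
    if "F \<in> {F. \<forall>m. Poly_Mapping.lookup F m \<in> S}" "G \<in> {F. \<forall>m. Poly_Mapping.lookup F m \<in> S}"
    for F G :: "'b \<Rightarrow>\<^sub>0 'a"
  proof -
    have "F * G = (\<Sum>k\<in>Poly_Mapping.keys F. Poly_Mapping.single k (Poly_Mapping.lookup F k) * G)"
      by (subst (1) poly_mapping_eq_sum_single[of F]) (simp add: sum_distrib_right)
    then show ?thesis
      using that by (auto simp: lookup_sum lookup_single_mult intro!: sum_closed mult_closed)
  qed
qed (auto simp: lookup_add intro: add_closed uminus_closed)

text \<open>
  The new exponent vector is \<open>n k\<close>, given by its entries: divisibility of the entries by the
  power \<open>n\<close> is what makes them large.
\<close>

lemma single_power:
  fixes k :: "'a \<Rightarrow>\<^sub>0 int" and c :: "'b :: comm_ring_1"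
  obtains q where "Poly_Mapping.single k c ^ n = Poly_Mapping.single q (c ^ n)"
    "\<And>i. Poly_Mapping.lookup q i = int n * Poly_Mapping.lookup k i"
proof -
  have "\<exists>q. Poly_Mapping.single k c ^ n = Poly_Mapping.single q (c ^ n) \<and>
      (\<forall>i. Poly_Mapping.lookup q i = int n * Poly_Mapping.lookup k i)"
  proof (induction n)
    case 0
    show ?case by (intro exI[of _ 0]) simp
  next
    case (Suc n)
    then obtain q where "Poly_Mapping.single k c ^ n = Poly_Mapping.single q (c ^ n)"
      "\<forall>i. Poly_Mapping.lookup q i = int n * Poly_Mapping.lookup k i" by blast
    then show ?case
      by (intro exI[of _ "k + q"]) (simp add: mult_single lookup_add algebra_simps)
  qed
  then show thesis using that by blast
qed

lemma ct_single_mult: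
  "ct (Poly_Mapping.single k c * F) = c * Poly_Mapping.lookup F (- k)"
  by (simp add: ct_def lookup_single_mult)

lemma ct_add: "ct (F + G) = ct F + ct G"
  by (simp add: ct_def lookup_add)

lemma ct_sum: "ct (\<Sum>i\<in>I. f i) = (\<Sum>i\<in>I. ct (f i))"
  by (simp add: ct_def lookup_sum)

lemma ct_of_nat_mult: "ct (of_nat n * F) = of_nat n * ct F"
  by (induction n) (simp_all add: ct_def algebra_simps lookup_add)

section \<open>Rational numbers modulo a prime\<close>

text \<open>
  For prime \<open>p\<close> this is the localization of the integers at the ideal \<open>(p)\<close>, and \<open>divisible_at p\<close> below is
  its maximal ideal. Every rational number is integral at all large primes, so working in these
  rings makes it unnecessary to clear denominators.
\<close>

definition integral_at :: "nat \<Rightarrow> rat set" where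
  "integral_at p = {x. \<exists>a b. \<not> int p dvd b \<and> x = of_int a / of_int b}"

definition divisible_at :: "nat \<Rightarrow> rat set" where
  "divisible_at p = (*) (of_nat p) ` integral_at p"

lemma integral_at_subring:
  assumes "prime p"
  shows "unital_subring (integral_at p)"
proof
  show "1 \<in> integral_at p"
    using prime_gt_1_nat[OF assms] by (auto simp: integral_at_def intro!: exI[of _ 1])
  fix x y assume "x \<in> integral_at p" "y \<in> integral_at p"
  then obtain a b c d where ab: "\<not> int p dvd b" "x = of_int a / of_int b"
    and cd: "\<not> int p dvd d" "y = of_int c / of_int d"
    by (auto simp: integral_at_def)
  have nz: "b \<noteq> 0" "d \<noteq> 0" using ab cd by auto
  have bd: "\<not> int p dvd b * d"
    using ab cd assms by (simp add: prime_dvd_mult_iff)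
  have "x + y = of_int (a * d + c * b) / of_int (b * d)" "x * y = of_int (a * c) / of_int (b * d)"
    using nz by (simp_all add: ab cd field_simps)
  then show "x + y \<in> integral_at p" "x * y \<in> integral_at p"
    using bd unfolding integral_at_def by blast+
next
  fix x assume "x \<in> integral_at p"
  then show "- x \<in> integral_at p"
    by (auto simp: integral_at_def) (metis minus_divide_left of_int_minus)
qed

lemma divisible_at_zero: "prime p \<Longrightarrow> 0 \<in> divisible_at p"
  using unital_subring.zero_closed[OF integral_at_subring] by (force simp: divisible_at_def)

lemma divisible_at_add:
  "prime p \<Longrightarrow> x \<in> divisible_at p \<Longrightarrow> y \<in> divisible_at p \<Longrightarrow> x + y \<in> divisible_at p"
  unfolding divisible_at_def
  by (auto simp: distrib_left[symmetric] intro: unital_subring.add_closed[OF integral_at_subring])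

lemma divisible_at_mult:
  assumes "prime p" "x \<in> integral_at p" "y \<in> divisible_at p"
  shows "x * y \<in> divisible_at p"
proof -
  obtain z where z: "z \<in> integral_at p" "y = of_nat p * z"
    using assms(3) by (auto simp: divisible_at_def)
  have "x * z \<in> integral_at p"
    by (rule unital_subring.mult_closed[OF integral_at_subring[OF assms(1)] assms(2) z(1)])
  then show ?thesis
    unfolding divisible_at_def z(2) mult.left_commute[of x] by (rule imageI)
qed

lemma divisible_at_uminus:
  assumes "prime p" "x \<in> divisible_at p"
  shows "- x \<in> divisible_at p"
proof -
  have "- 1 \<in> integral_at p"
    using unital_subring.uminus_closed[OF integral_at_subring unital_subring.one_closed] assms(1)
      integral_at_subring by blast
  then show ?thesis
    using divisible_at_mult[OF assms(1) _ assms(2), of "- 1"] by simp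
qed

lemma divisible_at_sum:
  "prime p \<Longrightarrow> (\<And>i. i \<in> I \<Longrightarrow> f i \<in> divisible_at p) \<Longrightarrow> sum f I \<in> divisible_at p"
  by (induction I rule: infinite_finite_induct)
    (auto intro: divisible_at_zero divisible_at_add)

lemma one_not_divisible_at:
  assumes "prime p"
  shows "1 \<notin> divisible_at p"
proof
  assume "1 \<in> divisible_at p"
  then obtain a b where ab: "\<not> int p dvd b" "1 = of_nat p * (of_int a / of_int b :: rat)"
    by (auto simp only: divisible_at_def integral_at_def)
  have "b \<noteq> 0"
    using ab(1) by auto
  then have "of_int b = (of_int (int p * a) :: rat)"
    using ab(2) by (simp add: divide_simps)
  then have "b = int p * a"
    by (simp only: of_int_eq_iff)
  then show False
    using ab(1) by simp
qed

text \<open>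
  The Frobenius congruence for \<open>1 + n\<close> gives an induction for natural numbers; any integer is
  congruent to one.
\<close>

lemma fermat_int:
  assumes "prime p"
  shows "int p dvd a ^ p - a"
proof -
  interpret unital_subring "UNIV :: int set"
    by standard auto
  have nat: "int p dvd int n ^ p - int n" for n
  proof (induction n)
    case 0
    show ?case using prime_gt_0_nat[OF assms] by (simp add: power_0_left)
  next
    case (Suc n)
    obtain K where "(1 + int n) ^ p = 1 ^ p + int n ^ p + of_nat p * K"
      using frobenius_add[OF assms, of 1 "int n"] by auto
    then have "int (Suc n) ^ p - int (Suc n) = (int n ^ p - int n) + int p * K"
      by simp
    then show ?case
      using Suc.IH by (metis dvd_add dvd_triv_left)
  qed
  have "a mod int p = int (nat (a mod int p))"
    using prime_gt_0_nat[OF assms] by simp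
  then have "int p dvd (a mod int p) ^ p - a mod int p"
    using nat[of "nat (a mod int p)"] by metis
  then show ?thesis
    by (simp add: mod_eq_dvd_iff[symmetric] power_mod)
qed

text \<open>
  For \<open>x = a / b\<close> the numerator of \<open>x ^ p - x\<close> over the denominator \<open>b ^ p * b\<close> is
  \<open>a ^ p * b - a * b ^ p\<close>, and both products are congruent to \<open>a * b\<close>.
\<close>

lemma fermat_integral_at:
  assumes "prime p" "x \<in> integral_at p"
  shows "x ^ p - x \<in> divisible_at p"
proof -
  obtain a b where ab: "\<not> int p dvd b" "x = of_int a / of_int b"
    using assms(2) by (auto simp: integral_at_def)
  have b: "b \<noteq> 0" using ab by auto
  have "int p dvd b * (a ^ p - a) - a * (b ^ p - b)"
    by (intro dvd_diff[OF dvd_mult dvd_mult] fermat_int assms(1))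
  then have "int p dvd a ^ p * b - a * b ^ p"
    by (simp add: algebra_simps)
  then obtain k where k: "a ^ p * b - a * b ^ p = int p * k" by (elim dvdE)
  have "x ^ p - x = of_int (a ^ p * b - a * b ^ p) / of_int (b ^ p * b)"
    using b by (simp add: ab power_divide field_simps)
  also have "\<dots> = of_nat p * (of_int k / of_int (b ^ p * b))"
    unfolding k by simp
  also have "\<dots> \<in> divisible_at p"
  proof -
    have "\<not> int p dvd b ^ p * b"
      using ab(1) assms(1) prime_dvd_power[of "int p" b p] by (auto simp: prime_dvd_mult_iff)
    then show ?thesis
      unfolding divisible_at_def integral_at_def by blast
  qed
  finally show ?thesis .
qed

lemma eventually_integral_at: "\<forall>\<^sub>F p in sequentially. x \<in> integral_at p"
proof -
  obtain a b where ab: "b > 0" "x = of_int a / of_int b"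
    by (cases x) (auto simp: Fract_of_int_quotient)
  have "x \<in> integral_at p" if "p > nat b" for p
  proof -
    have "\<not> int p dvd b"
      using that ab(1) zdvd_not_zless[of b "int p"] by linarith
    then show ?thesis using ab(2) by (auto simp: integral_at_def)
  qed
  then show ?thesis
    using eventually_gt_at_top[of "nat b"] by (rule eventually_mono[rotated])
qed

text \<open>
  If \<open>x \<noteq> 0\<close> were divisible at \<open>p\<close> while \<open>inverse x\<close> is integral there, their product \<open>1\<close> would be
  divisible at \<open>p\<close>.
\<close>

lemma eventually_not_divisible_at:
  assumes "x \<noteq> 0"
  shows "\<forall>\<^sub>F p in sequentially. prime p \<longrightarrow> x \<notin> divisible_at p"
  using eventually_integral_at[of "inverse x"]
proof eventually_elim
  case (elim p)
  show ?case
    using divisible_at_mult[OF _ elim, of x] one_not_divisible_at assms by auto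
qed

lemma eventually_integral_coeffs:
  fixes P :: "rat poly"
  shows "\<forall>\<^sub>F p in sequentially. prime p \<longrightarrow> (\<forall>i. coeff P i \<in> integral_at p)"
proof -
  have "\<forall>\<^sub>F p in sequentially. \<forall>i\<in>{..degree P}. coeff P i \<in> integral_at p"
    by (intro eventually_ball_finite) (auto intro: eventually_integral_at)
  then show ?thesis
  proof eventually_elim
    case (elim p)
    show ?case
      using elim unital_subring.zero_closed[OF integral_at_subring]
      by (metis atMost_iff coeff_eq_0 not_le)
  qed
qed

lemma eventually_integral_laurent:
  fixes F :: "'a \<Rightarrow>\<^sub>0 rat"
  shows "\<forall>\<^sub>F p in sequentially. prime p \<longrightarrow> (\<forall>m. Poly_Mapping.lookup F m \<in> integral_at p)"
proof -
  have "\<forall>\<^sub>F p in sequentially. \<forall>m\<in>Poly_Mapping.keys F. Poly_Mapping.lookup F m \<in> integral_at p"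
    by (intro eventually_ball_finite) (auto intro: eventually_integral_at)
  then show ?thesis
  proof eventually_elim
    case (elim p)
    show ?case
      using elim unital_subring.zero_closed[OF integral_at_subring]
      by (metis in_keys_iff)
  qed
qed

section \<open>Congruences for constant terms\<close>

lemma eventually_exponents_less:
  fixes F :: laurent
  shows "\<forall>\<^sub>F p in sequentially.
    \<forall>m\<in>Poly_Mapping.keys F. \<forall>i. \<bar>Poly_Mapping.lookup m i\<bar> < int p"
proof (intro eventually_ball_finite ballI)
  fix m :: "nat \<Rightarrow>\<^sub>0 int"
  have "\<forall>\<^sub>F p in sequentially. \<forall>i\<in>Poly_Mapping.keys m. \<bar>Poly_Mapping.lookup m i\<bar> < int p"
  proof (intro eventually_ball_finite ballI)
    fix i
    show "\<forall>\<^sub>F p in sequentially. \<bar>Poly_Mapping.lookup m i\<bar> < int p"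
      using eventually_gt_at_top[of "nat \<bar>Poly_Mapping.lookup m i\<bar>"]
      by eventually_elim linarith
  qed simp
  then show "\<forall>\<^sub>F p in sequentially. \<forall>i. \<bar>Poly_Mapping.lookup m i\<bar> < int p"
    using eventually_gt_at_top[of 0]
  proof eventually_elim
    case (elim p)
    show ?case
    proof
      fix i
      show "\<bar>Poly_Mapping.lookup m i\<bar> < int p"
        using elim by (cases "i \<in> Poly_Mapping.keys m") (auto simp: in_keys_iff)
    qed
  qed
qed simp

text \<open>
  Modulo \<open>p\<close>, the power \<open>P ^ p\<close> is the sum of the \<open>p\<close>-th powers of the terms of \<open>P\<close>. A nonconstant
  one has an exponent of absolute value at least \<open>p\<close>, which no monomial of \<open>F\<close> can cancel; the
  constant one contributes \<open>ct P ^ p * ct F\<close>, to which Fermat's congruence applies.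
\<close>

lemma ct_power_prime_mult:
  assumes p: "prime p"
    and P: "\<And>m. Poly_Mapping.lookup P m \<in> integral_at p"
    and F: "\<And>m. Poly_Mapping.lookup F m \<in> integral_at p"
    and small: "\<And>m i. m \<in> Poly_Mapping.keys F \<Longrightarrow> \<bar>Poly_Mapping.lookup m i\<bar> < int p"
  shows "ct (P ^ p * F) - ct P * ct F \<in> divisible_at p"
proof -
  interpret O: unital_subring "integral_at p"
    by (rule integral_at_subring[OF p])
  interpret L: unital_subring "{F :: laurent. \<forall>m. Poly_Mapping.lookup F m \<in> integral_at p}"
    by (rule O.laurent_subring)
  define f where "f k = Poly_Mapping.single k (Poly_Mapping.lookup P k)" for k
  have "f k \<in> {F :: laurent. \<forall>m. Poly_Mapping.lookup F m \<in> integral_at p}" for k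
    using P O.zero_closed by (simp add: f_def lookup_single when_def)
  then obtain K where K: "\<forall>m. Poly_Mapping.lookup K m \<in> integral_at p"
    and PK: "sum f (Poly_Mapping.keys P) ^ p = (\<Sum>k\<in>Poly_Mapping.keys P. f k ^ p) + of_nat p * K"
    using L.frobenius_sum[OF p finite_keys[of P], of f] by auto
  have ct_summand: "ct (f k ^ p * F) = (if k = 0 then ct P ^ p * ct F else 0)" for k
  proof -
    obtain q where q: "f k ^ p = Poly_Mapping.single q (Poly_Mapping.lookup P k ^ p)"
      "\<And>i. Poly_Mapping.lookup q i = int p * Poly_Mapping.lookup k i"
      using single_power[of k "Poly_Mapping.lookup P k" p] unfolding f_def by blast
    show ?thesis
    proof (cases "k = 0")
      case True
      then have "q = 0" using q(2) by (intro poly_mapping_eqI) simp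
      then show ?thesis using True q(1) by (simp add: ct_single_mult) (simp add: ct_def)
    next
      case False
      then obtain i where i: "Poly_Mapping.lookup k i \<noteq> 0"
        by (metis poly_mapping_eqI lookup_zero)
      have "int p * 1 \<le> int p * \<bar>Poly_Mapping.lookup k i\<bar>"
        using i by (intro mult_left_mono) auto
      then have "\<not> \<bar>Poly_Mapping.lookup (- q) i\<bar> < int p"
        by (simp add: q(2) abs_mult)
      then have "Poly_Mapping.lookup F (- q) = 0"
        using small[of "- q" i] by (auto simp: in_keys_iff)
      then show ?thesis using False by (simp add: q(1) ct_single_mult)
    qed
  qed
  have "P ^ p * F = (\<Sum>k\<in>Poly_Mapping.keys P. f k ^ p * F) + of_nat p * (K * F)"
    using PK poly_mapping_eq_sum_single[of P]
    by (simp add: f_def algebra_simps sum_distrib_left)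
  then have "ct (P ^ p * F) =
      (\<Sum>k\<in>Poly_Mapping.keys P. ct (f k ^ p * F)) + of_nat p * ct (K * F)"
    by (simp add: ct_add ct_sum ct_of_nat_mult)
  also have "(\<Sum>k\<in>Poly_Mapping.keys P. ct (f k ^ p * F)) = ct P ^ p * ct F"
    unfolding ct_summand using prime_gt_0_nat[OF p] by (simp add: in_keys_iff ct_def)
  finally have eq: "ct (P ^ p * F) - ct P * ct F = ct F * (ct P ^ p - ct P) + of_nat p * ct (K * F)"
    by (simp add: algebra_simps)
  have "ct (K * F) \<in> integral_at p"
    using L.mult_closed[of K F] K F by (simp add: ct_def)
  then have "of_nat p * ct (K * F) \<in> divisible_at p"
    by (auto simp: divisible_at_def)
  moreover have "ct F * (ct P ^ p - ct P) \<in> divisible_at p"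
    using P F by (intro divisible_at_mult fermat_integral_at p) (simp_all add: ct_def)
  ultimately show ?thesis
    unfolding eq by (intro divisible_at_add p)
qed

lemma shift_apply_integral:
  assumes "prime p" "\<And>i. coeff P i \<in> integral_at p" "\<And>n. A n \<in> integral_at p"
  shows "shift_apply P A n \<in> integral_at p"
proof -
  interpret unital_subring "integral_at p"
    by (rule integral_at_subring[OF assms(1)])
  show ?thesis
    unfolding shift_apply_def by (intro sum_closed mult_closed assms)
qed

lemma shift_apply_divisible:
  assumes "prime p" "\<And>i. coeff P i \<in> integral_at p" "\<And>n. A n \<in> divisible_at p"
  shows "shift_apply P A n \<in> divisible_at p"
  unfolding shift_apply_def by (intro divisible_at_sum divisible_at_mult assms)

text \<open>
  This is \<open>(N - c) ^ p \<equiv> N ^ p - c\<close> for the shift \<open>N\<close>. The prime \<open>2\<close> is left out so that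
  \<open>(- c) ^ p = - (c ^ p)\<close>.
\<close>

lemma shift_apply_linear_power_prime:
  assumes p: "prime p" "p > 2"
    and c: "c \<in> integral_at p" and A: "\<And>n. A n \<in> integral_at p"
  shows "shift_apply ([:- c, 1:] ^ p) A n - (A (n + p) - c * A n) \<in> divisible_at p"
proof -
  interpret O: unital_subring "integral_at p"
    by (rule integral_at_subring[OF p(1)])
  interpret L: unital_subring "{P. \<forall>i. coeff P i \<in> integral_at p}"
    by (rule O.poly_subring)
  have "[:0, 1:] \<in> {P. \<forall>i. coeff P i \<in> integral_at p}" "[:- c:] \<in> {P. \<forall>i. coeff P i \<in> integral_at p}"
    using c by (auto simp: coeff_pCons O.zero_closed O.one_closed O.uminus_closed split: nat.splits)
  then obtain K where K: "\<forall>i. coeff K i \<in> integral_at p"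
    and eq: "([:0, 1:] + [:- c:]) ^ p = [:0, 1:] ^ p + [:- c:] ^ p + of_nat p * K"
    using L.frobenius_add[OF p(1), of "[:0, 1:]" "[:- c:]"] by auto
  have "odd p"
    using p by (rule prime_odd_nat)
  then have "[:- c, 1:] ^ p = [:0, 1:] ^ p + ([:- (c ^ p):] + smult (of_nat p) K)"
    using eq by (simp add: poly_const_pow of_nat_poly)
  then have "shift_apply ([:- c, 1:] ^ p) A n =
      A (n + p) - c ^ p * A n + of_nat p * shift_apply K A n"
    by (simp add: shift_apply_add shift_apply_X_power shift_apply_smult shift_apply_pCons)
  then have "shift_apply ([:- c, 1:] ^ p) A n - (A (n + p) - c * A n) =
      - (A n * (c ^ p - c)) + of_nat p * shift_apply K A n"
    by (simp add: algebra_simps)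
  moreover have "of_nat p * shift_apply K A n \<in> divisible_at p"
    using shift_apply_integral[of p K A n] p K A by (auto simp: divisible_at_def)
  moreover have "- (A n * (c ^ p - c)) \<in> divisible_at p"
    by (intro divisible_at_uminus divisible_at_mult fermat_integral_at p A c)
  ultimately show ?thesis
    by (simp only: divisible_at_add p)
qed

text \<open>
  As the leading coefficient of \<open>R\<close> is a unit modulo \<open>p\<close>, the recurrence determines all terms modulo
  \<open>p\<close> from the first \<open>degree R\<close> ones. Hence a congruence that is known for these only, with a bound
  on \<open>p\<close> depending on their number, extends to the whole sequence for the same \<open>p\<close>.
\<close>

lemma divisible_if_annihilated:
  assumes p: "prime p" and "annihilates R B"
    and R: "\<And>i. coeff R i \<in> integral_at p" "inverse (lead_coeff R) \<in> integral_at p"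
    and "R \<noteq> 0" and init: "\<And>n. n < degree R \<Longrightarrow> B n \<in> divisible_at p"
  shows "B n \<in> divisible_at p"
proof (induction n rule: less_induct)
  case (less n)
  show ?case
  proof (cases "n < degree R")
    case False
    define d k where "d = degree R" and "k = n - degree R"
    then have n: "n = k + d" using False by simp
    have "(\<Sum>l\<le>d. coeff R l * B (k + l)) = 0"
      using assms(2) by (simp add: annihilates_def shift_apply_def d_def)
    then have "lead_coeff R * B n = - (\<Sum>l<d. coeff R l * B (k + l))"
      by (simp add: lessThan_Suc_atMost[symmetric] n d_def add_eq_0_iff)
    moreover have "(\<Sum>l<d. coeff R l * B (k + l)) \<in> divisible_at p"
      using n by (intro divisible_at_sum divisible_at_mult less p R) auto
    ultimately have "inverse (lead_coeff R) * (lead_coeff R * B n) \<in> divisible_at p"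
      by (simp add: divisible_at_mult divisible_at_uminus p R del: mult_minus_right)
    then show ?thesis
      using \<open>R \<noteq> 0\<close> by (simp add: mult.assoc[symmetric])
  qed (rule init)
qed

section \<open>The characteristic polynomial of a constant term\<close>

text \<open>
  In the proof \<open>x\<close> stands for the polynomial \<open>[:- c, 1:]\<close>, and \<open>w\<close> is its inverse modulo \<open>q\<close>. The exponent \<open>i\<close>
  is the multiplicity of the root \<open>c\<close> in some annihilating polynomial and does not depend on the
  primes that are used to show that \<open>B = (N - c) ^ i A\<close> vanishes.
\<close>

lemma constant_term_annihilated_by_linear_power:
  assumes "C_finite A" and A: "\<And>n. A n = ct (P ^ n * Q)"
  obtains i where "annihilates ([:- ct P, 1:] ^ i) A"
proof -
  define c where "c = ct P"
  define x where "x = [:- c, 1:]"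
  obtain R where R: "R \<noteq> 0" "annihilates R A"
    using assms(1) by (auto simp: C_finite_def)
  define i where "i = order c R"
  obtain q where q: "R = x ^ i * q" "\<not> x dvd q"
    using order_decomp[OF R(1), of c] by (auto simp: x_def i_def)
  define u where "u = poly q c"
  have u: "u \<noteq> 0"
    using q(2) by (simp add: x_def u_def poly_eq_0_iff_dvd)
  have "poly (q - [:u:]) c = 0"
    by (simp add: u_def)
  then obtain r where r: "q - [:u:] = x * r"
    unfolding poly_eq_0_iff_dvd x_def by (elim dvdE)
  define w where "w = smult (- inverse u) r"
  have xw: "1 - x * w = smult (inverse u) q"
  proof -
    have "x * w = smult (- inverse u) (q - [:u:])"
      by (simp add: w_def r)
    then show ?thesis
      using u by (simp add: smult_diff_right one_pCons)
  qed
  define B where "B = shift_apply (x ^ i) A"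
  have "shift_apply q B = (\<lambda>n. 0)"
    using R(2) unfolding B_def annihilates_iff q(1) shift_apply_mult[symmetric]
    by (simp add: mult.commute)
  then have "shift_apply (1 - x * w) B n = 0" for n
    by (simp add: xw shift_apply_smult)
  then have Bxw: "shift_apply (x * w) B = B"
    by (simp add: fun_eq_iff shift_apply_diff)
  have Bpow: "B = shift_apply (w ^ k * x ^ i) (shift_apply (x ^ k) A)" for k
  proof -
    have "shift_apply ((x * w) ^ k) B = B"
    proof (induction k)
      case (Suc k)
      then show ?case
        by (simp only: power_Suc shift_apply_mult[of "x * w"] Bxw)
    qed simp
    then show ?thesis
      by (simp add: B_def power_mult_distrib mult.commute mult.left_commute
          flip: shift_apply_mult)
  qed
  have "B n = 0" for n
  proof (rule ccontr)
    assume nz: "B n \<noteq> 0"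
    \<comment> \<open>All denominators in sight, the exponents of the first \<open>degree R\<close> products \<open>P ^ k * Q\<close>, and
      the nonzero number \<open>B n\<close> exclude only finitely many primes.\<close>
    define good where "good = (\<lambda>p. p > 2 \<and> (prime p \<longrightarrow> B n \<notin> divisible_at p) \<and>
        (prime p \<longrightarrow> (\<forall>m. Poly_Mapping.lookup P m \<in> integral_at p)) \<and>
        (prime p \<longrightarrow> (\<forall>m. Poly_Mapping.lookup Q m \<in> integral_at p)) \<and>
        (prime p \<longrightarrow> (\<forall>i. coeff R i \<in> integral_at p)) \<and>
        (prime p \<longrightarrow> (\<forall>i. coeff w i \<in> integral_at p)) \<and>
        inverse (lead_coeff R) \<in> integral_at p \<and>
        (\<forall>k\<in>{..<degree R}. \<forall>m\<in>Poly_Mapping.keys (P ^ k * Q). \<forall>i.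
          \<bar>Poly_Mapping.lookup m i\<bar> < int p))"
    have "eventually good sequentially"
      unfolding good_def
      by (intro eventually_conj eventually_gt_at_top eventually_not_divisible_at[OF nz]
          eventually_integral_laurent eventually_integral_coeffs eventually_integral_at
          eventually_ball_finite ballI eventually_exponents_less finite_lessThan)
    then obtain N where "\<And>p. p \<ge> N \<Longrightarrow> good p"
      unfolding eventually_sequentially by blast
    moreover obtain p where p: "prime p" "p > N"
      using bigger_prime by blast
    ultimately have "good p"
      by simp
    then have large: "p > 2" "B n \<notin> divisible_at p"
        "\<And>m. Poly_Mapping.lookup P m \<in> integral_at p"
        "\<And>m. Poly_Mapping.lookup Q m \<in> integral_at p"
        "\<And>i. coeff R i \<in> integral_at p" "\<And>i. coeff w i \<in> integral_at p"
        "inverse (lead_coeff R) \<in> integral_at p"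
      and small: "\<And>k m i. k < degree R \<Longrightarrow> m \<in> Poly_Mapping.keys (P ^ k * Q) \<Longrightarrow>
          \<bar>Poly_Mapping.lookup m i\<bar> < int p"
      using p(1) unfolding good_def by blast+
    interpret O: unital_subring "integral_at p"
      by (rule integral_at_subring[OF p(1)])
    interpret L: unital_subring "{F :: laurent. \<forall>m. Poly_Mapping.lookup F m \<in> integral_at p}"
      by (rule O.laurent_subring)
    interpret X: unital_subring "{P. \<forall>i. coeff P i \<in> integral_at p}"
      by (rule O.poly_subring)
    have P: "P \<in> {F. \<forall>m. Poly_Mapping.lookup F m \<in> integral_at p}"
      and Q: "Q \<in> {F. \<forall>m. Poly_Mapping.lookup F m \<in> integral_at p}"
      using large by auto
    have PQ: "Poly_Mapping.lookup (P ^ k * Q) m \<in> integral_at p" for k m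
      using L.mult_closed[OF L.power_closed[OF P] Q] by auto
    have A_int: "A k \<in> integral_at p" for k
      using PQ by (simp add: A ct_def)
    have c_int: "c \<in> integral_at p"
      using P by (simp add: c_def ct_def)
    \<comment> \<open>The defect of the congruence \<open>A (k + p) \<equiv> c * A k\<close>, itself a solution of the recurrence.\<close>
    define D where "D k = A (k + p) - c * A k" for k
    have "D k \<in> divisible_at p" if "k < degree R" for k
    proof -
      have "ct (P ^ p * (P ^ k * Q)) - ct P * ct (P ^ k * Q) \<in> divisible_at p"
        by (intro ct_power_prime_mult p large PQ small[OF that])
      then show ?thesis
        by (simp add: D_def A c_def power_add ac_simps)
    qed
    moreover have "annihilates R D"
    proof -
      define G where "G = [:0, 1:] ^ p - [:c:]"
      have "D = shift_apply G A"
        by (simp add: D_def G_def fun_eq_iff shift_apply_diff shift_apply_X_power shift_apply_pCons)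
      moreover have "annihilates (R * G) A"
        unfolding mult.commute[of R G] by (rule annihilates_mult[OF R(2)])
      ultimately show ?thesis
        by (simp only: annihilates_iff shift_apply_mult)
    qed
    ultimately have D: "D k \<in> divisible_at p" for k
      using divisible_if_annihilated[OF p(1) _ large(5) large(7) R(1), of D] by blast
    have "shift_apply (x ^ p) A k \<in> divisible_at p" for k
    proof -
      have "shift_apply (x ^ p) A k - D k \<in> divisible_at p"
        unfolding x_def D_def
        by (intro shift_apply_linear_power_prime p large c_int A_int)
      from divisible_at_add[OF p(1) this D[of k]] show ?thesis by simp
    qed
    moreover have "w ^ p * x ^ i \<in> {P. \<forall>i. coeff P i \<in> integral_at p}"
    proof -
      have "x \<in> {P. \<forall>i. coeff P i \<in> integral_at p}"
        using c_int by (auto simp: x_def coeff_pCons O.zero_closed O.one_closed O.uminus_closed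
            split: nat.splits)
      moreover have "w \<in> {P. \<forall>i. coeff P i \<in> integral_at p}"
        using large by auto
      ultimately show ?thesis
        by (intro X.mult_closed X.power_closed)
    qed
    ultimately have "shift_apply (w ^ p * x ^ i) (shift_apply (x ^ p) A) n \<in> divisible_at p"
      by - (rule shift_apply_divisible[OF p(1)], auto)
    then show False
      using large(2) Bpow[of p] by simp
  qed
  then have "annihilates (x ^ i) A"
    by (simp add: annihilates_def B_def)
  then show thesis
    using that by (simp add: x_def c_def)
qed

section \<open>Sequences with a single rational characteristic root\<close>

text \<open>
  The \<open>T k\<close> are the coefficients of \<open>A\<close> in the basis \<open>(n choose k) * l ^ (n - k)\<close>, which is the
  coefficient of \<open>x ^ k\<close> in \<open>(x + l) ^ n\<close>; pairing with \<open>T k * x ^ (- k)\<close> extracts it. One variable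
  suffices.
\<close>

lemma constant_term_if_annihilated_by_linear_power:
  assumes "annihilates ([:- l, 1:] ^ m) A"
  shows "constant_term A"
proof -
  define T where "T k = shift_apply ([:- l, 1:] ^ k) A 0" for k
  have T0: "T k = 0" if "k \<ge> m" for k
  proof -
    have "[:- l, 1:] ^ k = [:- l, 1:] ^ (k - m) * [:- l, 1:] ^ m"
      using that by (simp flip: power_add)
    then show ?thesis
      using annihilates_mult[OF assms, of "[:- l, 1:] ^ (k - m)"]
      by (simp add: T_def annihilates_def)
  qed
  have A: "A n = (\<Sum>k\<le>n. of_nat (n choose k) * (l ^ (n - k) * T k))" for n
  proof -
    have "[:0, 1:] ^ n = ([:- l, 1:] + [:l:]) ^ n"
      by simp
    also have "\<dots> = (\<Sum>k\<le>n. of_nat (n choose k) * [:- l, 1:] ^ k * [:l:] ^ (n - k))"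
      by (rule binomial_ring)
    also have "\<dots> = (\<Sum>k\<le>n. smult (of_nat (n choose k) * l ^ (n - k)) ([:- l, 1:] ^ k))"
      by (intro sum.cong) (simp_all add: poly_const_pow of_nat_poly mult.commute)
    finally have "A n = shift_apply \<dots> A 0"
      using shift_apply_X_power[of n A 0] by simp
    then show ?thesis
      by (simp add: shift_apply_sum shift_apply_smult T_def mult.assoc)
  qed
  define e :: "int \<Rightarrow> nat \<Rightarrow>\<^sub>0 int" where "e = Poly_Mapping.single 0"
  define P :: laurent where "P = Poly_Mapping.single (e 1) 1 + Poly_Mapping.single 0 l"
  define Q :: laurent where "Q = (\<Sum>k<m. Poly_Mapping.single (e (- int k)) (T k))"
  have e_inj: "e i = e j \<longleftrightarrow> i = j" for i j
    by (simp add: e_def inj_eq)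
  have e_add: "e i + e j = e (i + j)" for i j
    by (simp add: e_def single_add)
  have e_0: "e 0 = 0"
    by (simp add: e_def)
  have Q: "Poly_Mapping.lookup Q (- e (int k)) = T k" for k
  proof -
    have "- e (int k) = e (- int k)"
      by (simp add: e_def single_uminus)
    then show ?thesis
      using T0[of k] by (auto simp: Q_def lookup_sum lookup_single when_def e_inj)
  qed
  have e_pow: "Poly_Mapping.single (e 1) 1 ^ k = (Poly_Mapping.single (e (int k)) 1 :: laurent)" for k
    by (induction k) (simp_all add: mult_single e_0 e_add)
  have l_pow: "Poly_Mapping.single 0 l ^ k = (Poly_Mapping.single 0 (l ^ k) :: laurent)" for k
    by (induction k) (simp_all add: mult_single)
  have "A n = ct (P ^ n * Q)" for n
  proof -
    have "P ^ n = (\<Sum>k\<le>n. of_nat (n choose k) * Poly_Mapping.single (e 1) 1 ^ k *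
        Poly_Mapping.single 0 l ^ (n - k))"
      unfolding P_def by (rule binomial_ring)
    also have "\<dots> = (\<Sum>k\<le>n. of_nat (n choose k) * Poly_Mapping.single (e (int k)) (l ^ (n - k)))"
      by (simp add: e_pow l_pow mult_single mult.assoc)
    finally have "ct (P ^ n * Q) =
        (\<Sum>k\<le>n. of_nat (n choose k) * ct (Poly_Mapping.single (e (int k)) (l ^ (n - k)) * Q))"
      by (simp add: sum_distrib_right ct_sum mult.assoc ct_of_nat_mult)
    then show ?thesis
      by (simp add: A ct_single_mult Q)
  qed
  moreover have "P \<in> laurent_ring 1"
    using keys_add[of "Poly_Mapping.single (e 1) 1" "Poly_Mapping.single 0 l"]
    by (force simp: laurent_ring_def P_def e_def split: if_splits)
  moreover have "Q \<in> laurent_ring 1"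
  proof -
    have "Poly_Mapping.keys Q \<subseteq> range e"
      using keys_sum[of "\<lambda>k. Poly_Mapping.single (e (- int k)) (T k)" "{..<m}"]
      by (auto simp: Q_def split: if_splits)
    then show ?thesis
      by (force simp: laurent_ring_def e_def split: if_splits)
  qed
  ultimately show ?thesis
    unfolding constant_term_def by blast
qed

theorem proposition1p4:
  fixes A :: "nat \<Rightarrow> rat"
  assumes "C_finite A"
    and "\<exists>n. A n \<noteq> 0"
  shows "constant_term A \<longleftrightarrow> (\<exists>r. char_roots A = {r} \<and> r \<in> \<rat>)"
proof
  assume "constant_term A"
  then obtain P Q where "\<And>n. A n = ct (P ^ n * Q)"
    by (auto simp: constant_term_def)
  then obtain m where m: "annihilates ([:- ct P, 1:] ^ m) A"
    using constant_term_annihilated_by_linear_power[OF assms(1)] by blast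
  have root: "z = of_rat (ct P)"
    if M: "minimal_annihilator M A" and z: "poly (map_poly of_rat M) z = 0" for M and z :: complex
  proof -
    obtain K where "[:- ct P, 1:] ^ m = M * K"
      using minimal_annihilator_dvd[OF M m] by (elim dvdE)
    then have "(z - of_rat (ct P)) ^ m = 0"
      using poly_of_rat_linear_power[of "ct P" m z] z by (simp add: poly_of_rat_mult)
    then show ?thesis by simp
  qed
  obtain M where M: "minimal_annihilator M A"
    using minimal_annihilator_exists[OF assms(1)] .
  \<comment> \<open>A constant annihilator would force \<open>A = 0\<close>.\<close>
  have "degree M > 0"
  proof (rule ccontr)
    assume "\<not> degree M > 0"
    then obtain a where "M = [:a:]"
      using degree_eq_zeroE by blast
    then show False
      using M assms(2) by (auto simp: minimal_annihilator_def annihilates_def shift_apply_pCons)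
  qed
  then obtain z :: complex where "poly (map_poly of_rat M) z = 0"
    by (rule complex_root_exists)
  then have "char_roots A = {of_rat (ct P)}"
    using root M by (auto simp: char_roots_def)
  then show "\<exists>r. char_roots A = {r} \<and> r \<in> \<rat>"
    by auto
next
  assume "\<exists>r. char_roots A = {r} \<and> r \<in> \<rat>"
  then obtain l where l: "char_roots A = {of_rat l}"
    by (auto elim: Rats_cases)
  obtain M where M: "minimal_annihilator M A"
    using minimal_annihilator_exists[OF assms(1)] .
  then have "M \<noteq> 0" "annihilates M A"
    by (auto simp: minimal_annihilator_def)
  moreover have "z = of_rat l" if "poly (map_poly of_rat M) z = 0" for z :: complex
    using l M that by (auto simp: char_roots_def)
  ultimately obtain a m where "a \<noteq> 0" "M = smult a ([:- l, 1:] ^ m)"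
    using eq_linear_power_if_single_root by metis
  then have "annihilates ([:- l, 1:] ^ m) A"
    using \<open>annihilates M A\<close> by (simp add: annihilates_def shift_apply_smult)
  then show "constant_term A"
    by (rule constant_term_if_annihilated_by_linear_power)
qed

end
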